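(* Let $v_{\infty1}>v_{\infty2}>0$ and $n_1>n_2>1$. There is a unique coincidence point $\Phi\in\partial^1$. Upon the choice of parameters there may exist up to two coincidence points $\Phi\in\partial^2$.
   Context: Phase space: $\mathcal D=\{\Phi=(\phi_1,\phi_2)^{\mathrm T}\in\mathbb R^2:\phi_1\ge0,\ \phi_2\ge0,\ \phi:=\phi_1+\phi_2\le 1\}$ (maximum packing concentration equal to $1$), with axes $\partial^1=\{(\phi,0)^{\mathrm T}:\phi\in[0,1]\}$ and $\partial^2=\{(0,\phi)^{\mathrm T}:\phi\in[0,1]\}$. The parameters are the constants $v_{\infty1},v_{\infty2},n_1,n_2$. On $\mathcal D$ set $u_i(\Phi)=v_{\infty i}(1-\phi)^{n_i-1}$, $v_i(\Phi)=u_i(\Phi)-\phi_1u_1(\Phi)-\phi_2u_2(\Phi)$, $f_i(\Phi)=\phi_iv_i(\Phi)$ for $i=1,2$, and $\boldsymbol f=(f_1,f_2)^{\mathrm T}$. A point $\Phi$ is called a coincidence point of the system $\partial_t\phi_i+\partial_xf_i(\Phi)=0$, $i=1,2$, if the two eigenvalues of the Jacobian matrix of $\boldsymbol f$ coincide at this point (on the boundary of $\mathcal D$ the Jacobian is that of the defining formula for $\boldsymbol f$).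
   Formalization: Coincidence points are counted only where φ<1: at the vertices (1,0) and (0,1) the Jacobian vanishes for all admissible parameters, so these are always coincidence points and the claim counted on the full axes would be false. *)

theory Defs
  imports "HOL-Analysis.Analysis"
begin

definition conc :: "real^2 \<Rightarrow> real" where
  "conc \<Phi> = \<Phi>$1 + \<Phi>$2"

definition phase_space :: "(real^2) set" where
  "phase_space = {\<Phi>. \<Phi>$1 \<ge> 0 \<and> \<Phi>$2 \<ge> 0 \<and> conc \<Phi> \<le> 1}"

definition axis1 :: "(real^2) set" where
  "axis1 = {vector [s, 0] |s. s \<in> {0..1}}"

definition axis2 :: "(real^2) set" where
  "axis2 = {vector [0, s] |s. s \<in> {0..1}}"

text \<open>The parameters are the vectors \<open>v\<close> (velocities at infinite dilution) and \<open>n\<close> (exponents).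
  The formulas are taken on the whole plane, so that a two-sided Jacobian makes sense on the
  boundary of the phase space. The values for \<open>conc \<Phi> > 1\<close>, where \<open>powr\<close> is applied to a negative
  base, do not influence the Jacobian at points with \<open>conc \<Phi> < 1\<close>.\<close>

definition u_vel :: "real^2 \<Rightarrow> real^2 \<Rightarrow> 2 \<Rightarrow> real^2 \<Rightarrow> real" where
  "u_vel v n i \<Phi> = v$i * (1 - conc \<Phi>) powr (n$i - 1)"

definition v_vel :: "real^2 \<Rightarrow> real^2 \<Rightarrow> 2 \<Rightarrow> real^2 \<Rightarrow> real" where
  "v_vel v n i \<Phi> = u_vel v n i \<Phi> - \<Phi>$1 * u_vel v n 1 \<Phi> - \<Phi>$2 * u_vel v n 2 \<Phi>"

definition flux :: "real^2 \<Rightarrow> real^2 \<Rightarrow> real^2 \<Rightarrow> real^2" where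
  "flux v n \<Phi> = (\<chi> i. \<Phi>$i * v_vel v n i \<Phi>)"

definition charpoly :: "real^'n^'n \<Rightarrow> complex poly" where
  "charpoly A = det (\<chi> i j. (if i = j then [:0, 1:] else 0) - [:complex_of_real (A$i$j):])"

text \<open>The complex eigenvalues, counted with algebraic multiplicity.\<close>

definition eigenvalues :: "real^'n^'n \<Rightarrow> complex multiset" where
  "eigenvalues A = proots (charpoly A)"

definition coincidence_point :: "real^2 \<Rightarrow> real^2 \<Rightarrow> real^2 \<Rightarrow> bool" where
  "coincidence_point v n \<Phi> \<longleftrightarrow>
     \<Phi> \<in> phase_space \<and> flux v n differentiable (at \<Phi>) \<and>
     (\<exists>l. eigenvalues (jacobian (flux v n) (at \<Phi>)) = {#l, l#})"

text \<open>For all exponents greater than 1 the Jacobian vanishes at the two points of the axes with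
  maximal concentration, so these vertices are always coincidence points, in a degenerate sense.
  Statements counting the coincidence points on an axis therefore have to be read on the part
  \<open>conc \<Phi> < 1\<close>.\<close>

lemma has_derivative_zero_product:
  fixes g h :: "'a::real_normed_vector \<Rightarrow> real"
  assumes "(g has_derivative g') (at x)" "g x = 0" "isCont h x" "h x = 0"
  shows "((\<lambda>y. g y * h y) has_derivative (\<lambda>_. 0)) (at x)"
proof -
  have lin: "bounded_linear g'" using assms(1) by (rule has_derivative_bounded_linear)
  have lim: "((\<lambda>y. (g y - g x - g' (y - x)) /\<^sub>R norm (y - x)) \<longlongrightarrow> 0) (at x)"
    using assms(1) by (simp add: has_derivative_at_within)
  have h0: "(h \<longlongrightarrow> 0) (at x)" using assms(3,4) by (simp add: isCont_def)
  have a: "((\<lambda>y. (g y - g x - g' (y - x)) /\<^sub>R norm (y - x) * h y) \<longlongrightarrow> 0) (at x)"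
    using tendsto_mult[OF lim h0] by simp
  obtain K where K: "\<And>z. norm (g' z) \<le> norm z * K" "K > 0"
    using bounded_linear.pos_bounded[OF lin] by blast
  have b: "((\<lambda>y. g' (y - x) /\<^sub>R norm (y - x) * h y) \<longlongrightarrow> 0) (at x)"
  proof (rule Lim_null_comparison)
    show "((\<lambda>y. K * \<bar>h y\<bar>) \<longlongrightarrow> 0) (at x)"
      using tendsto_mult[OF tendsto_const[of K] tendsto_rabs[OF h0]] by simp
    show "\<forall>\<^sub>F y in at x. norm (g' (y - x) /\<^sub>R norm (y - x) * h y) \<le> K * \<bar>h y\<bar>"
      unfolding eventually_at_filter
    proof (intro always_eventually allI impI)
      fix y assume "y \<noteq> x"
      then have "\<bar>g' (y - x)\<bar> / norm (y - x) \<le> K"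
        using K(1)[of "y - x"] by (simp add: field_simps)
      then have "\<bar>g' (y - x)\<bar> / norm (y - x) * \<bar>h y\<bar> \<le> K * \<bar>h y\<bar>"
        by (rule mult_right_mono) simp
      then show "norm (g' (y - x) /\<^sub>R norm (y - x) * h y) \<le> K * \<bar>h y\<bar>"
        by (simp add: abs_mult divide_inverse_commute)
    qed
  qed
  have "((\<lambda>y. (g y * h y) /\<^sub>R norm (y - x)) \<longlongrightarrow> 0) (at x)"
    using tendsto_add[OF a b] assms(2) by (simp add: algebra_simps)
  then show ?thesis
    using assms(2) by (simp add: has_derivative_at_within)
qed

lemma coincidence_point_vertex:
  fixes v n \<Phi> :: "real^2"
  assumes "n$1 > 1" "n$2 > 1" and \<Phi>: "\<Phi> = vector [1, 0] \<or> \<Phi> = vector [0, 1]"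
  shows "coincidence_point v n \<Phi>"
proof -
  have n: "n$i > 1" for i using assms(1,2) exhaust_2[of i] by auto
  have c: "conc \<Phi> = 1" using \<Phi> by (auto simp: conc_def)
  have u0: "u_vel v n i \<Phi> = 0" for i by (simp add: u_vel_def c)
  have "((\<lambda>y. (1 - conc y) powr (n$i - 1)) \<longlongrightarrow> 0) (at \<Phi>)" for i
  proof -
    have "((\<lambda>y. \<bar>1 - conc y\<bar>) \<longlongrightarrow> \<bar>1 - conc \<Phi>\<bar>) (at \<Phi>)"
      unfolding conc_def by (intro tendsto_intros)
    then have "((\<lambda>y. \<bar>1 - conc y\<bar> powr (n$i - 1)) \<longlongrightarrow> \<bar>1 - conc \<Phi>\<bar> powr (n$i - 1)) (at \<Phi>)"
      by (rule tendsto_powr2) (use n[of i] in auto)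
    moreover have "\<bar>x\<bar> powr a = x powr a" for x a :: real
      by (cases "x \<ge> 0") (auto simp: powr_def ln_minus)
    ultimately show ?thesis by (simp add: c)
  qed
  then have uc: "isCont (u_vel v n i) \<Phi>" for i
    unfolding isCont_def u0 unfolding u_vel_def by (rule tendsto_mult_right_zero)
  have z: "((\<lambda>y. g y * u_vel v n i y) has_derivative (\<lambda>_. 0)) (at \<Phi>)"
    if "g differentiable (at \<Phi>)" "g \<Phi> = 0" for g i
    using that uc u0 has_derivative_zero_product unfolding differentiable_def by blast
  have d: "(\<lambda>y::real^2. y$i) differentiable (at \<Phi>)" for i
    by (rule bounded_linear_imp_differentiable) (rule bounded_linear_vec_nth)
  have dm: "(\<lambda>y::real^2. y$i * y$j) differentiable (at \<Phi>)"
    "(\<lambda>y::real^2. y$i * (1 - y$i)) differentiable (at \<Phi>)" for i j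
    by (intro differentiable_mult differentiable_diff d differentiable_const)+
  have v0: "\<Phi>$1 * \<Phi>$2 = 0" "\<Phi>$2 * \<Phi>$1 = 0" "\<Phi>$1 * (1 - \<Phi>$1) = 0" "\<Phi>$2 * (1 - \<Phi>$2) = 0"
    using \<Phi> by auto
  have f1: "(\<lambda>y. flux v n y $ 1) =
      (\<lambda>y. (y$1 * (1 - y$1)) * u_vel v n 1 y - (y$1 * y$2) * u_vel v n 2 y)"
    by (auto simp: flux_def v_vel_def algebra_simps)
  have f2: "(\<lambda>y. flux v n y $ 2) =
      (\<lambda>y. (y$2 * (1 - y$2)) * u_vel v n 2 y - (y$2 * y$1) * u_vel v n 1 y)"
    by (auto simp: flux_def v_vel_def algebra_simps)
  have "((\<lambda>y. flux v n y $ 1) has_derivative (\<lambda>_. 0)) (at \<Phi>)"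
    unfolding f1 using has_derivative_diff[OF z[OF dm(2)[of 1] v0(3)] z[OF dm(1)[of 1 2] v0(1)]]
    by simp
  moreover have "((\<lambda>y. flux v n y $ 2) has_derivative (\<lambda>_. 0)) (at \<Phi>)"
    unfolding f2 using has_derivative_diff[OF z[OF dm(2)[of 2] v0(4)] z[OF dm(1)[of 2 1] v0(2)]]
    by simp
  ultimately have "((\<lambda>y. flux v n y $ i) has_derivative (\<lambda>_. 0 $ i)) (at \<Phi>)" for i
    using exhaust_2[of i] by auto
  then have D: "(flux v n has_derivative (\<lambda>_. 0)) (at \<Phi>)"
    by (subst has_derivative_componentwise_within) 
       (auto simp: Basis_vec_def inner_axis)
  have "jacobian (flux v n) (at \<Phi>) = 0"
    using frechet_derivative_at[OF D]
    by (simp add: jacobian_def matrix_def vec_eq_iff flip: frechet_derivative_at[OF D])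
  moreover have "eigenvalues (0 :: real^2^2) = {#0, 0#}"
  proof -
    have "charpoly (0 :: real^2^2) = [:0, 1:] * [:0, 1:]"
      by (simp add: charpoly_def det_2)
    moreover have "proots [:0, 1 :: complex:] = {#0#}"
      using proots_linear_factor[of "0::complex"] by simp
    ultimately show ?thesis by (simp add: eigenvalues_def proots_mult del: mult_pCons_left mult_pCons_right)
  qed
  moreover have "\<Phi> \<in> phase_space"
    using \<Phi> c by (auto simp: phase_space_def)
  ultimately show ?thesis
    using D unfolding coincidence_point_def differentiable_def by auto
qed

end

theory Submission
  imports Defs
begin

text \<open>On each axis the Jacobian is triangular, so a coincidence point is a point where its two
  diagonal entries agree. With \<open>a = n\<^sub>1 - n\<^sub>2 > 0\<close>, and after division by
  \<open>(1 - s) powr (n\<^sub>2 - 1)\<close>, this reads \<open>v\<^sub>1 (1 - s) powr a * (1 - n\<^sub>1 s) = v\<^sub>2\<close> on the first axis. The left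
  side decreases strictly from \<open>v\<^sub>1 > v\<^sub>2\<close> to \<open>0\<close> on \<open>[0, 1 / n\<^sub>1]\<close> and is at most \<open>0\<close> afterwards, hence
  the unique solution. On the second axis it reads, for \<open>t = 1 - s\<close>,
  \<open>v\<^sub>2 (1 - n\<^sub>2 + n\<^sub>2 t) = v\<^sub>1 t powr a\<close>. Three solutions would, by Rolle's theorem applied twice, force
  \<open>a = 1\<close>, but then the equation is linear. For \<open>a = 1\<close> and \<open>a = 2\<close> the equation is elementary, and
  there are parameters with no solution, a double root, and two roots in \<open>(0, 1)\<close>.\<close>

text \<open>The vanishing product covers both shapes that occur: upper triangular on the first axis,
  lower triangular on the second.\<close>

lemma eigenvalues_triangular:
  fixes A :: "real^2^2"
  assumes "A$1$2 * A$2$1 = 0"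
  shows "eigenvalues A = {#complex_of_real (A$1$1), complex_of_real (A$2$2)#}"
proof -
  let ?a = "complex_of_real (A$1$1)" and ?d = "complex_of_real (A$2$2)"
  have "complex_of_real (A$1$2) * complex_of_real (A$2$1) = 0"
    using assms by auto
  then have "charpoly A = [:- ?a, 1:] * [:- ?d, 1:]"
    by (auto simp: charpoly_def det_2)
  moreover have "proots ([:- ?a, 1:] * [:- ?d, 1:]) = proots [:- ?a, 1:] + proots [:- ?d, 1:]"
    by (rule proots_mult) auto
  moreover have "proots [:- x, 1:] = {#x#}" for x :: complex
    using proots_linear_factor[of "- x"] by simp
  ultimately show ?thesis
    by (simp add: eigenvalues_def)
qed

section \<open>Jacobian of the flux below maximal concentration\<close>

text \<open>The derivative of \<open>u_vel\<close> with respect to the total concentration, written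
  as a quotient so that multiplying by \<open>1 - conc \<Phi>\<close> returns a multiple of
  \<open>u_vel\<close>.\<close>

definition u_slope :: "real^2 \<Rightarrow> real^2 \<Rightarrow> 2 \<Rightarrow> real^2 \<Rightarrow> real" where
  "u_slope v n i \<Phi> = - (n$i - 1) * u_vel v n i \<Phi> / (1 - conc \<Phi>)"

lemma u_vel_has_derivative:
  assumes "conc \<Phi> < 1"
  shows "(u_vel v n i has_derivative (\<lambda>h. u_slope v n i \<Phi> * conc h)) (at \<Phi>)"
proof -
  have "bounded_linear conc"
    unfolding conc_def by (intro bounded_linear_add bounded_linear_vec_nth)
  then have conc: "(conc has_derivative conc) (at \<Phi>)"
    by (rule bounded_linear_imp_has_derivative)
  have lin: "((\<lambda>c. 1 - c) has_real_derivative - 1) (at (conc \<Phi>))"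
    by (auto intro!: derivative_eq_intros)
  have power: "(1 - conc \<Phi>) powr (n$i - 2) = (1 - conc \<Phi>) powr (n$i - 1) / (1 - conc \<Phi>)"
    using assms powr_diff[of "1 - conc \<Phi>" "n$i - 1" 1] by simp
  from DERIV_fun_powr[OF lin, of "n$i - 1"]
  have "((\<lambda>c. v$i * (1 - c) powr (n$i - 1)) has_real_derivative u_slope v n i \<Phi>) (at (conc \<Phi>))"
    using assms
    by (auto dest!: DERIV_cmult[where c = "v$i"] elim!: DERIV_cong
        simp: u_slope_def u_vel_def power algebra_simps)
  from DERIV_compose_FDERIV[OF this conc] show ?thesis
    by (simp add: u_vel_def [abs_def] mult.commute)
qed

lemma flux_has_derivative:
  assumes "conc \<Phi> < 1"
  shows "(flux v n has_derivative (\<lambda>h. \<chi> i. h$i * v_vel v n i \<Phi> +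
           \<Phi>$i * (u_slope v n i \<Phi> * conc h
             - h$1 * u_vel v n 1 \<Phi> - \<Phi>$1 * (u_slope v n 1 \<Phi> * conc h)
             - h$2 * u_vel v n 2 \<Phi> - \<Phi>$2 * (u_slope v n 2 \<Phi> * conc h)))) (at \<Phi>)"
    (is "(_ has_derivative ?D) _")
proof -
  have nth: "((\<lambda>y. y$i) has_derivative (\<lambda>h. h$i)) (at \<Phi>)" for i :: 2
    by (intro bounded_linear_imp_has_derivative bounded_linear_vec_nth)
  have "((\<lambda>y. y$i * v_vel v n i y) has_derivative (\<lambda>h. ?D h $ i)) (at \<Phi>)" for i
    unfolding v_vel_def
    by (rule has_derivative_eq_rhs,
        (rule has_derivative_mult has_derivative_diff nth u_vel_has_derivative[OF assms])+)
       (auto simp: fun_eq_iff algebra_simps)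
  then show ?thesis
    by (subst has_derivative_componentwise_within)
       (auto simp: Basis_vec_def inner_axis flux_def)
qed

text \<open>The \<open>u_vel\<close> depend on \<open>conc\<close> alone, whose partial derivatives
  are both 1, so \<open>j\<close> survives only in the diagonal term and in
  \<open>u_vel v n j\<close>. The factor \<open>\<Phi>$i\<close> makes the matrix triangular on the
  axes.\<close>

lemma jacobian_flux:
  assumes "conc \<Phi> < 1"
  shows "jacobian (flux v n) (at \<Phi>) $ i $ j = (if i = j then v_vel v n i \<Phi> else 0) +
           \<Phi>$i * (u_slope v n i \<Phi> - u_vel v n j \<Phi>
             - \<Phi>$1 * u_slope v n 1 \<Phi> - \<Phi>$2 * u_slope v n 2 \<Phi>)"
  using exhaust_2[of j]
  by (auto simp: jacobian_def matrix_def conc_def axis_def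
      frechet_derivative_at[OF flux_has_derivative[OF assms], symmetric])

lemma coincidence_point_triangular:
  fixes v n \<Phi> :: "real^2"
  defines "J \<equiv> jacobian (flux v n) (at \<Phi>)"
  assumes "\<Phi> \<in> phase_space" "conc \<Phi> < 1" "J$1$2 * J$2$1 = 0"
  shows "coincidence_point v n \<Phi> \<longleftrightarrow> J$1$1 = J$2$2"
proof -
  have "flux v n differentiable (at \<Phi>)"
    using flux_has_derivative[OF assms(3)] unfolding differentiable_def by blast
  then show ?thesis
    using eigenvalues_triangular[OF assms(4)] assms(2)
    by (auto simp: coincidence_point_def J_def add_eq_conv_ex)
qed

section \<open>Scalar equations on the axes\<close>

text \<open>The diagonal entries are \<open>u1 * (1 - s - n$1 * s)\<close> and
  \<open>u2 - s * u1\<close>, where \<open>ui\<close> is \<open>u_vel v n i\<close>. The term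
  \<open>s * u1\<close> cancels, and so does the positive factor
  \<open>(1 - s) powr (n$2 - 1)\<close>.\<close>

lemma coincidence_point_axis1:
  fixes v n :: "real^2"
  assumes "0 \<le> s" "s < 1"
  shows "coincidence_point v n (vector [s, 0]) \<longleftrightarrow>
           v$1 * (1 - s) powr (n$1 - n$2) * (1 - n$1 * s) = v$2"
proof -
  let ?\<Phi> = "vector [s, 0] :: real^2"
  have c: "conc ?\<Phi> = s"
    by (simp add: conc_def)
  have slope: "(1 - s) * u_slope v n i ?\<Phi> = - (n$i - 1) * u_vel v n i ?\<Phi>" for i
    using assms by (simp add: u_slope_def c)
  have "coincidence_point v n ?\<Phi> \<longleftrightarrow>
      jacobian (flux v n) (at ?\<Phi>) $ 1 $ 1 = jacobian (flux v n) (at ?\<Phi>) $ 2 $ 2"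
    using assms
    by (intro coincidence_point_triangular) (simp_all add: c phase_space_def jacobian_flux)
  also have "\<dots> \<longleftrightarrow> u_vel v n 1 ?\<Phi> * (1 - n$1 * s) = u_vel v n 2 ?\<Phi>"
    using slope[of 1] assms by (simp add: jacobian_flux c v_vel_def) algebra
  also have "u_vel v n 1 ?\<Phi> = (1 - s) powr (n$2 - 1) * (v$1 * (1 - s) powr (n$1 - n$2))"
    by (simp add: u_vel_def c flip: powr_add)
  also have "u_vel v n 2 ?\<Phi> = (1 - s) powr (n$2 - 1) * v$2"
    by (simp add: u_vel_def c)
  finally show ?thesis
    using assms by auto
qed

text \<open>Here the diagonal entries are \<open>u1 - s * u2\<close> and
  \<open>u2 * (1 - s - n$2 * s)\<close>; the same positive factor is cancelled.\<close>

lemma coincidence_point_axis2: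
  fixes v n :: "real^2"
  assumes "0 \<le> s" "s < 1"
  shows "coincidence_point v n (vector [0, s]) \<longleftrightarrow>
           v$2 * (1 - n$2 * s) = v$1 * (1 - s) powr (n$1 - n$2)"
proof -
  let ?\<Phi> = "vector [0, s] :: real^2"
  have c: "conc ?\<Phi> = s"
    by (simp add: conc_def)
  have slope: "(1 - s) * u_slope v n i ?\<Phi> = - (n$i - 1) * u_vel v n i ?\<Phi>" for i
    using assms by (simp add: u_slope_def c)
  have "coincidence_point v n ?\<Phi> \<longleftrightarrow>
      jacobian (flux v n) (at ?\<Phi>) $ 1 $ 1 = jacobian (flux v n) (at ?\<Phi>) $ 2 $ 2"
    using assms
    by (intro coincidence_point_triangular) (simp_all add: c phase_space_def jacobian_flux)
  also have "\<dots> \<longleftrightarrow> u_vel v n 2 ?\<Phi> * (1 - n$2 * s) = u_vel v n 1 ?\<Phi>"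
    using slope[of 2] assms by (simp add: jacobian_flux c v_vel_def) algebra
  also have "u_vel v n 1 ?\<Phi> = (1 - s) powr (n$2 - 1) * (v$1 * (1 - s) powr (n$1 - n$2))"
    by (simp add: u_vel_def c flip: powr_add)
  also have "u_vel v n 2 ?\<Phi> = (1 - s) powr (n$2 - 1) * v$2"
    by (simp add: u_vel_def c)
  finally show ?thesis
    using assms by auto
qed

lemma ex1_coincidence_point_axis1:
  fixes v n :: "real^2"
  assumes "v$1 > v$2" "v$2 > 0" "n$1 > n$2" "n$2 > 1"
  shows "\<exists>!\<Phi>. \<Phi> \<in> axis1 \<and> conc \<Phi> < 1 \<and> coincidence_point v n \<Phi>"
proof -
  define g where "g s = v$1 * (1 - s) powr (n$1 - n$2) * (1 - n$1 * s)" for s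
  let ?r = "1 / n$1"
  have r: "0 < ?r" "?r < 1" and v1: "v$1 > 0"
    using assms by auto
  have "\<exists>s\<ge>0. s \<le> ?r \<and> g s = v$2"
  proof (rule IVT2')
    show "continuous_on {0..?r} g"
      unfolding g_def using r by (intro continuous_intros) auto
  qed (use assms r in \<open>auto simp: g_def\<close>)
  then obtain s where s: "0 \<le> s" "s < 1" "g s = v$2"
    using r by (meson le_less_trans)
  \<comment> \<open>The positive value at the larger point forces \<open>1 - n$1 * y > 0\<close>, so
    both decreasing factors are positive there and their product is strictly larger at
    \<open>x\<close>.\<close>
  have strict: "g y < g x" if "0 \<le> x" "x < y" "y < 1" "g y = v$2" for x y
  proof -
    have "0 < v$1 * (1 - y) powr (n$1 - n$2) * (1 - n$1 * y)"
      using that(4) assms(2) by (simp add: g_def)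
    moreover have "0 < v$1 * (1 - y) powr (n$1 - n$2)"
      using that(3) v1 by simp
    ultimately have y: "0 < 1 - n$1 * y"
      by (rule zero_less_mult_pos)
    have "(1 - y) powr (n$1 - n$2) < (1 - x) powr (n$1 - n$2)"
      using that assms by (intro powr_less_mono2) auto
    moreover have "1 - n$1 * y < 1 - n$1 * x"
      using that assms by simp
    ultimately have "(1 - y) powr (n$1 - n$2) * (1 - n$1 * y) < (1 - x) powr (n$1 - n$2) * (1 - n$1 * x)"
      using y by (intro mult_strict_mono) auto
    then show ?thesis
      using v1 by (simp add: g_def mult.assoc)
  qed
  have coin: "coincidence_point v n (vector [x, 0]) \<longleftrightarrow> g x = v$2" if "0 \<le> x" "x < 1" for x
    using coincidence_point_axis1[OF that] by (simp add: g_def)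
  show ?thesis
  proof (rule ex1I)
    show "vector [s, 0] \<in> axis1 \<and> conc (vector [s, 0]) < 1 \<and> coincidence_point v n (vector [s, 0])"
      using s coin by (auto simp: axis1_def conc_def)
  next
    fix \<Phi> assume "\<Phi> \<in> axis1 \<and> conc \<Phi> < 1 \<and> coincidence_point v n \<Phi>"
    then obtain x where x: "\<Phi> = vector [x, 0]" "0 \<le> x" "x < 1" "g x = v$2"
      using coin by (auto simp: axis1_def conc_def)
    then show "\<Phi> = vector [s, 0]"
      using strict[of x s] strict[of s x] s by (cases x s rule: linorder_cases) auto
  qed
qed

section \<open>Counting on the second axis\<close>

definition axis2_roots :: "real^2 \<Rightarrow> real^2 \<Rightarrow> real set" where
  "axis2_roots v n = {t. 0 < t \<and> t \<le> 1 \<and> v$2 * (1 - n$2 + n$2 * t) = v$1 * t powr (n$1 - n$2)}"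

lemma axis2_coincidence_points:
  "{\<Phi> \<in> axis2. conc \<Phi> < 1 \<and> coincidence_point v n \<Phi>} = (\<lambda>t. vector [0, 1 - t]) ` axis2_roots v n"
    (is "?L = ?R")
proof
  show "?L \<subseteq> ?R"
  proof
    fix \<Phi> assume "\<Phi> \<in> ?L"
    then obtain s where s: "\<Phi> = vector [0, s]" "0 \<le> s" "s < 1" "coincidence_point v n (vector [0, s])"
      by (auto simp: axis2_def conc_def)
    then have "1 - s \<in> axis2_roots v n"
      by (simp add: coincidence_point_axis2 axis2_roots_def algebra_simps)
    then show "\<Phi> \<in> ?R"
      using s(1) by (intro image_eqI[of _ _ "1 - s"]) auto
  qed
next
  show "?R \<subseteq> ?L"
    by (auto simp: axis2_roots_def coincidence_point_axis2 axis2_def conc_def algebra_simps)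
qed

text \<open>Finiteness is transferred along with the count, since \<open>card\<close> is 0 on
  infinite sets.\<close>

lemma finite_card_axis2:
  "finite {\<Phi> \<in> axis2. conc \<Phi> < 1 \<and> coincidence_point v n \<Phi>} \<longleftrightarrow> finite (axis2_roots v n)"
  "card {\<Phi> \<in> axis2. conc \<Phi> < 1 \<and> coincidence_point v n \<Phi>} = card (axis2_roots v n)"
proof -
  have "inj_on (\<lambda>t. vector [0, 1 - t] :: real^2) (axis2_roots v n)"
    by (rule inj_onI) (simp add: vec_eq_iff forall_2)
  then show
    "finite {\<Phi> \<in> axis2. conc \<Phi> < 1 \<and> coincidence_point v n \<Phi>} \<longleftrightarrow> finite (axis2_roots v n)"
    "card {\<Phi> \<in> axis2. conc \<Phi> < 1 \<and> coincidence_point v n \<Phi>} = card (axis2_roots v n)"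
    unfolding axis2_coincidence_points by (auto simp: finite_image_iff card_image)
qed

text \<open>Three distinct elements could be sorted into a forbidden chain, so all finite subsets
  have at most two elements; this uniform bound also yields finiteness.\<close>

lemma finite_card_le_2I:
  fixes A :: "'a :: linorder set"
  assumes "\<And>x y z. x \<in> A \<Longrightarrow> y \<in> A \<Longrightarrow> z \<in> A \<Longrightarrow> x < y \<Longrightarrow> y < z \<Longrightarrow> False"
  shows "finite A \<and> card A \<le> 2"
proof -
  have "card B \<le> 2" if "B \<subseteq> A" "finite B" for B
  proof (rule ccontr)
    assume "\<not> card B \<le> 2"
    then have "3 \<le> card B" by simp
    then obtain C where "C \<subseteq> B" "card C = 3"
      by (meson obtain_subset_with_card_n)
    then obtain x y z where "C = {x, y, z}" "x \<noteq> y" "y \<noteq> z" "x \<noteq> z"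
      by (meson card_3_iff)
    moreover have "C \<subseteq> A"
      using \<open>C \<subseteq> B\<close> \<open>B \<subseteq> A\<close> by (rule subset_trans)
    ultimately show False
      using assms by (metis insert_subset linorder_neqE)
  qed
  then show ?thesis
    by (metis finite_if_finite_subsets_card_bdd order_refl)
qed

lemma axis2_roots_le_2:
  fixes v n :: "real^2"
  assumes "v$1 > v$2" "v$2 > 0" "n$1 > n$2" "n$2 > 1"
  shows "finite (axis2_roots v n) \<and> card (axis2_roots v n) \<le> 2"
proof (rule finite_card_le_2I)
  fix x y z
  assume roots: "x \<in> axis2_roots v n" "y \<in> axis2_roots v n" "z \<in> axis2_roots v n"
    and less: "x < y" "y < z"
  define a where "a = n$1 - n$2"
  define h where "h t = v$2 * (1 - n$2 + n$2 * t) - v$1 * t powr a" for t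
  define h' where "h' t = v$2 * n$2 - v$1 * a * t powr (a - 1)" for t
  have h: "h x = 0" "h y = 0" "h z = 0" and x: "0 < x"
    using roots by (auto simp: axis2_roots_def h_def a_def)
  have a: "a > 0" and v1: "v$1 > 0"
    using assms by (auto simp: a_def)
  have dh: "(h has_real_derivative h' t) (at t)" if "0 < t" for t
    unfolding h_def h'_def using that by (auto intro!: derivative_eq_intros)
  have dh': "(h' has_real_derivative - v$1 * a * ((a - 1) * t powr (a - 2))) (at t)"
    if "0 < t" for t
    unfolding h'_def using that by (auto intro!: derivative_eq_intros)
  have "\<exists>t>p. t < q \<and> h' t = 0" if pq: "0 < p" "p < q" "h p = h q" for p q
  proof -
    have "\<exists>t>p. t < q \<and> h q - h p = (q - p) * h' t"
      by (rule MVT2) (use pq dh in auto)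
    with pq show ?thesis by auto
  qed
  from this[of x y] this[of y z] obtain p q
    where pq: "x < p" "p < y" "h' p = 0" "y < q" "q < z" "h' q = 0"
    using h x less by auto
  \<comment> \<open>The left side is 0, and on the right only the factor \<open>a - 1\<close> can
    vanish.\<close>
  have "\<exists>t>p. t < q \<and> h' q - h' p = (q - p) * (- v$1 * a * ((a - 1) * t powr (a - 2)))"
    by (rule MVT2) (use pq x dh' in auto)
  then have "a = 1"
    using pq x a v1 by auto
  \<comment> \<open>Now \<open>h\<close> is affine and \<open>h' p = 0\<close> makes its slope
    vanish, so \<open>h\<close> is the negative constant \<open>v$2 * (1 - n$2)\<close>,
    contradicting \<open>h x = 0\<close>.\<close>
  then have "v$2 * n$2 = v$1"
    using pq x by (simp add: h'_def)
  with h(1) \<open>a = 1\<close> x have "v$2 * (1 - n$2) = 0"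
    by (simp add: h_def algebra_simps)
  with assms show False by auto
qed

lemma axis2_roots_witnesses:
  "axis2_roots (vector [2, 1]) (vector [3, 2]) = {}"
  "axis2_roots (vector [9/8, 1]) (vector [7/2, 3/2]) = {2/3}"
  "axis2_roots (vector [10/9, 1]) (vector [7/2, 3/2]) = {3/4, 3/5}"
proof -
  \<comment> \<open>The exponent is 1 and the two sides are the parallel lines
    \<open>2 * t - 1\<close> and \<open>2 * t\<close>.\<close>
  show "axis2_roots (vector [2, 1]) (vector [3, 2]) = {}"
    by (auto simp: axis2_roots_def)
  \<comment> \<open>With exponent 2 and leading coefficient \<open>c\<close>, the quadratic has
    discriminant \<open>9/4 - 2 * c\<close>, which vanishes at \<open>c = 9/8\<close>.\<close>
  have "1 - 3/2 + 3/2 * t = 9/8 * t^2 \<longleftrightarrow> t = 2/3" for t :: real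
  proof -
    have "1 - 3/2 + 3/2 * t = 9/8 * t^2 \<longleftrightarrow> (3 * t - 2)^2 = 0"
      by (auto simp: power2_eq_square field_simps)
    then show ?thesis by auto
  qed
  then show "axis2_roots (vector [9/8, 1]) (vector [7/2, 3/2]) = {2/3}"
    by (auto simp: axis2_roots_def power2_eq_square)
  \<comment> \<open>Every \<open>c\<close> between 1 and 9/8 gives two roots in (0, 1);
    \<open>c = 10/9\<close> has discriminant 1/36, so they are rational.\<close>
  have "1 - 3/2 + 3/2 * t = 10/9 * t^2 \<longleftrightarrow> t = 3/4 \<or> t = 3/5" for t :: real
  proof -
    have "1 - 3/2 + 3/2 * t = 10/9 * t^2 \<longleftrightarrow> (4 * t - 3) * (5 * t - 3) = 0"
      by (auto simp: power2_eq_square field_simps)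
    then show ?thesis by auto
  qed
  then show "axis2_roots (vector [10/9, 1]) (vector [7/2, 3/2]) = {3/4, 3/5}"
    by (auto simp: axis2_roots_def power2_eq_square)
qed

theorem lemma9:
  fixes v n :: "real^2"
  assumes "v$1 > v$2" "v$2 > 0" "n$1 > n$2" "n$2 > 1"
  shows "(\<exists>!\<Phi>. \<Phi> \<in> axis1 \<and> conc \<Phi> < 1 \<and> coincidence_point v n \<Phi>) \<and>
         finite {\<Phi> \<in> axis2. conc \<Phi> < 1 \<and> coincidence_point v n \<Phi>} \<and>
         card {\<Phi> \<in> axis2. conc \<Phi> < 1 \<and> coincidence_point v n \<Phi>} \<le> 2 \<and>
         (\<forall>k\<le>2. \<exists>w m :: real^2. w$1 > w$2 \<and> w$2 > 0 \<and> m$1 > m$2 \<and> m$2 > 1 \<and>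
            finite {\<Phi> \<in> axis2. conc \<Phi> < 1 \<and> coincidence_point w m \<Phi>} \<and>
            card {\<Phi> \<in> axis2. conc \<Phi> < 1 \<and> coincidence_point w m \<Phi>} = k)"
proof (intro conjI allI impI)
  show "\<exists>!\<Phi>. \<Phi> \<in> axis1 \<and> conc \<Phi> < 1 \<and> coincidence_point v n \<Phi>"
    by (rule ex1_coincidence_point_axis1[OF assms])
  show "finite {\<Phi> \<in> axis2. conc \<Phi> < 1 \<and> coincidence_point v n \<Phi>}"
    "card {\<Phi> \<in> axis2. conc \<Phi> < 1 \<and> coincidence_point v n \<Phi>} \<le> 2"
    using axis2_roots_le_2[OF assms] by (simp_all add: finite_card_axis2)
next
  fix k :: nat assume "k \<le> 2"
  then consider "k = 0" | "k = 1" | "k = 2" by linarith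
  then show "\<exists>w m :: real^2. w$1 > w$2 \<and> w$2 > 0 \<and> m$1 > m$2 \<and> m$2 > 1 \<and>
      finite {\<Phi> \<in> axis2. conc \<Phi> < 1 \<and> coincidence_point w m \<Phi>} \<and>
      card {\<Phi> \<in> axis2. conc \<Phi> < 1 \<and> coincidence_point w m \<Phi>} = k"
  proof cases
    case 1
    then show ?thesis
      by (intro exI[of _ "vector [2, 1]"] exI[of _ "vector [3, 2]"])
         (simp add: finite_card_axis2 axis2_roots_witnesses)
  next
    case 2
    then show ?thesis
      by (intro exI[of _ "vector [9/8, 1]"] exI[of _ "vector [7/2, 3/2]"])
         (simp add: finite_card_axis2 axis2_roots_witnesses)
  next
    case 3
    then show ?thesis
      by (intro exI[of _ "vector [10/9, 1]"] exI[of _ "vector [7/2, 3/2]"])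
         (simp add: finite_card_axis2 axis2_roots_witnesses)
  qed
qed

end
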